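(* For every integer $n\ge 2$, the polynomial $T_n(x)=\sum_{\sigma\in\mathfrak{B}_n}x^{\operatorname{des}_D\sigma}$ has only real roots. In fact, for every $0\le i<2n$, the polynomial $T_{n,i}(x)=\sum_{\mathbf{e}\in\mathfrak{I}_n^{(2,4,\dots,2n)},\ e_n=i}x^{\operatorname{asc}_D\mathbf{e}}$ has only real roots.
   Context: $\mathfrak{B}_n$ is the set of signed permutations of $\{1,\dots,n\}$, i.e. sequences $\sigma=(\sigma_1,\dots,\sigma_n)$ of nonzero integers such that $(|\sigma_1|,\dots,|\sigma_n|)$ is a permutation of $\{1,\dots,n\}$. For $\sigma\in\mathfrak{B}_n$ ($n\ge2$), the type $D$ descent set, with respect to the usual order of the integers, is $\operatorname{Des}_D\sigma=\{i\in\{1,\dots,n-1\}\mid \sigma_i>\sigma_{i+1}\}\cup\{0 \mid \text{if } \sigma_1+\sigma_2<0\}$, and $\operatorname{des}_D\sigma=|\operatorname{Des}_D\sigma|$. $\mathfrak{I}_n^{(2,4,\dots,2n)}=\{(e_1,\dots,e_n)\in\mathbb{Z}^n\mid 0\le e_i<2i \text{ for } 1\le i\le n\}$. For $\mathbf{e}=(e_1,\dots,e_n)$ in this set, the type $D$ ascent set is $\operatorname{Asc}_D\mathbf{e}=\{i\in\{1,\dots,n-1\}\mid e_i/i<e_{i+1}/(i+1)\}\cup\{0\mid\text{if } e_1+e_2/2\ge 3/2\}$, and $\operatorname{asc}_D\mathbf{e}=|\operatorname{Asc}_D\mathbf{e}|$. A polynomial "has only real roots" if all its complex roots are real. *)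

theory Defs
  imports "HOL-Computational_Algebra.Polynomial" "HOL-Library.FuncSet" Complex_Main
begin

text \<open>
  A finite sequence indexed by \<open>1, \<dots>, n\<close> is an extensional function on \<open>{1..n}\<close>
  (with value \<^term>\<open>undefined\<close> elsewhere), so that distinct functions are distinct sequences.
\<close>

definition signed_perms :: "nat \<Rightarrow> (nat \<Rightarrow> int) set" where
  "signed_perms n =
     {\<sigma> \<in> extensional {1..n}. bij_betw (\<lambda>i. \<bar>\<sigma> i\<bar>) {1..n} {1..int n}}"

definition Des_D :: "nat \<Rightarrow> (nat \<Rightarrow> int) \<Rightarrow> nat set" where
  "Des_D n \<sigma> =
     {i \<in> {1..<n}. \<sigma> i > \<sigma> (i + 1)} \<union> (if \<sigma> 1 + \<sigma> 2 < 0 then {0} else {})"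

definition des_D :: "nat \<Rightarrow> (nat \<Rightarrow> int) \<Rightarrow> nat" where
  "des_D n \<sigma> = card (Des_D n \<sigma>)"

definition inversion_seqs :: "nat \<Rightarrow> (nat \<Rightarrow> int) set" where
  "inversion_seqs n = (\<Pi>\<^sub>E i\<in>{1..n}. {0..<2 * int i})"

definition Asc_D :: "nat \<Rightarrow> (nat \<Rightarrow> int) \<Rightarrow> nat set" where
  "Asc_D n e =
     {i \<in> {1..<n}. real_of_int (e i) / real i < real_of_int (e (i + 1)) / real (i + 1)} \<union>
     (if real_of_int (e 1) + real_of_int (e 2) / 2 \<ge> 3 / 2 then {0} else {})"

definition asc_D :: "nat \<Rightarrow> (nat \<Rightarrow> int) \<Rightarrow> nat" where
  "asc_D n e = card (Asc_D n e)"

definition T_poly :: "nat \<Rightarrow> real poly" where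
  "T_poly n = (\<Sum>\<sigma>\<in>signed_perms n. monom 1 (des_D n \<sigma>))"

definition T_poly_last :: "nat \<Rightarrow> int \<Rightarrow> real poly" where
  "T_poly_last n i = (\<Sum>e\<in>{e \<in> inversion_seqs n. e n = i}. monom 1 (asc_D n e))"

definition only_real_roots :: "real poly \<Rightarrow> bool" where
  "only_real_roots p \<longleftrightarrow> (\<forall>z::complex. poly (map_poly of_real p) z = 0 \<longrightarrow> z \<in> \<real>)"

text \<open>The sums above range over finite sets.\<close>

lemma finite_inversion_seqs: "finite (inversion_seqs n)"
  unfolding inversion_seqs_def by (intro finite_PiE) auto

lemma finite_signed_perms: "finite (signed_perms n)"
proof (rule finite_subset)
  show "signed_perms n \<subseteq> (\<Pi>\<^sub>E i\<in>{1..n}. {- int n..int n})"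
  proof
    fix \<sigma> assume "\<sigma> \<in> signed_perms n"
    hence ext: "\<sigma> \<in> extensional {1..n}"
      and bij: "bij_betw (\<lambda>i. \<bar>\<sigma> i\<bar>) {1..n} {1..int n}"
      by (auto simp: signed_perms_def)
    have "\<sigma> i \<in> {- int n..int n}" if "i \<in> {1..n}" for i
      using bij_betwE[OF bij] that by (fastforce simp: abs_le_iff)
    with ext show "\<sigma> \<in> (\<Pi>\<^sub>E i\<in>{1..n}. {- int n..int n})"
      by (auto simp: PiE_def)
  qed
  show "finite (\<Pi>\<^sub>E i\<in>{1..n}. {- int n..int n})"
    by (intro finite_PiE) auto
qed

end

theory Submission
  imports Defs
begin

text \<open>
  Fix \<open>z\<close> in the upper half plane. If the polynomials \<open>f\<^sub>0, \<dots>, f\<^sub>m\<close> successively interlace, then the values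
  \<open>f\<^sub>i(z)\<close> turn counterclockwise with \<open>i\<close>, by a total angle of at most \<open>arg z\<close>. This condition is
  given by the inequalities \<open>Im (cnj (f\<^sub>i(z)) f\<^sub>j(z)) \<ge> 0\<close> and \<open>Im (cnj (f\<^sub>j(z)) z f\<^sub>i(z)) \<ge> 0\<close>
  for \<open>i \<le> j\<close>, which are bilinear in the values. Hence it passes to the sums
  \<open>z (\<Sum>l<t. f\<^sub>l(z)) + (\<Sum>l\<ge>t. f\<^sub>l(z))\<close> indexed by increasing thresholds \<open>t\<close>, and it forces these sums not to vanish.
  The polynomials \<open>T\<^sub>n\<^sub>,\<^sub>i\<close> satisfy such a threshold recurrence in \<open>n\<close>. They interlace only from \<open>n = 4\<close> on, so that
  \<open>n = 4\<close> is the base case and \<open>n = 2, 3\<close> are treated by hand. The polynomial of the signed permutations is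
  \<open>T\<^sub>n = \<Sum>\<^sub>i T\<^sub>n\<^sub>,\<^sub>i = T\<^sub>n\<^sub>+\<^sub>1\<^sub>,\<^sub>0\<close>, since a signed Lehmer code carries descents to ascents.
\<close>

section \<open>Signed Lehmer codes\<close>

text \<open>Counting larger elements is strictly decreasing in \<open>a\<close>, hence injective;
  \<open>a\<close> is not counted itself, so the count stays below \<open>card S\<close>, and equal
  cardinalities give surjectivity.\<close>

lemma bij_betw_card_greater:
  fixes S :: "'a::linorder set"
  assumes "finite S"
  shows "bij_betw (\<lambda>a. card {b \<in> S. a < b}) S {..<card S}"
proof -
  let ?r = "\<lambda>a. card {b \<in> S. a < b}"
  have less: "?r b < ?r a" if "a \<in> S" "b \<in> S" "a < b" for a b
    using that assms by (intro psubset_card_mono) auto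
  have inj: "inj_on ?r S"
  proof (rule inj_onI)
    fix a b assume "a \<in> S" "b \<in> S" "?r a = ?r b"
    thus "a = b" using less[of a b] less[of b a] by (cases a b rule: linorder_cases) simp_all
  qed
  have "?r a < card S" if "a \<in> S" for a
  proof -
    have "?r a \<le> card (S - {a})" using assms by (intro card_mono) auto
    thus ?thesis using card_Diff1_less[OF assms that] by linarith
  qed
  hence "?r ` S \<subseteq> {..<card S}" by blast
  with inj show ?thesis
    by (simp add: bij_betw_def card_image card_subset_eq)
qed

text \<open>Allowing an arbitrary set \<open>S\<close> of absolute values makes the bijection inductive: deleting the
  last entry of a signed permutation leaves no signed permutation, but an arrangement.\<close>
definition arrangements :: "int set \<Rightarrow> nat \<Rightarrow> (nat \<Rightarrow> int) set" where
  "arrangements S n = {\<sigma> \<in> extensional {1..n}. bij_betw (\<lambda>i. \<bar>\<sigma> i\<bar>) {1..n} S}"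

text \<open>The digit \<open>t\<close> of the usual Lehmer code of the absolute values lies in
  \<open>{0..<i}\<close>; a negative sign reflects it into the upper half
  \<open>{i..<2 * i}\<close>. With the earlier entries fixed, the digit thus weakly decreases as the
  signed entry grows, which is why descents turn into ascents.\<close>

definition signed_lehmer :: "nat \<Rightarrow> (nat \<Rightarrow> int) \<Rightarrow> nat \<Rightarrow> int" where
  "signed_lehmer n \<sigma> = (\<lambda>i\<in>{1..n}. let t = int (card {j \<in> {1..<i}. \<bar>\<sigma> i\<bar> < \<bar>\<sigma> j\<bar>}) in
     if 0 < \<sigma> i then t else 2 * int i - 1 - t)"

text \<open>This is the last digit of the code, expressed by the last entry \<open>s\<close> and the
  set \<open>S\<close> of all absolute values alone.\<close>

definition signed_rank :: "int set \<Rightarrow> int \<Rightarrow> int" where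
  "signed_rank S s = (let t = int (card {b \<in> S. \<bar>s\<bar> < b}) in
     if 0 < s then t else 2 * int (card S) - 1 - t)"

lemma bij_betw_signed_rank:
  assumes "finite S" "S \<subseteq> {0<..}"
  shows "bij_betw (signed_rank S) {s. \<bar>s\<bar> \<in> S} {0..<2 * int (card S)}"
proof -
  note r = bij_betw_card_greater[OF assms(1)]
  have inj: "a = b" if "a \<in> S" "b \<in> S" "card {c \<in> S. a < c} = card {c \<in> S. b < c}" for a b
    using r that by (auto simp: bij_betw_def inj_on_def)
  have lt: "card {c \<in> S. a < c} < card S" if "a \<in> S" for a
    using r that by (auto simp: bij_betw_def)
  have ex: "\<exists>a\<in>S. card {c \<in> S. a < c} = k" if "k < card S" for k
    using r that unfolding bij_betw_def by (metis (no_types, lifting) imageE lessThan_iff)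
  have nz: "s \<noteq> 0" if "\<bar>s\<bar> \<in> S" for s using that assms(2) by auto
  show ?thesis
  proof (rule bij_betwI')
    fix x y assume xy: "x \<in> {s. \<bar>s\<bar> \<in> S}" "y \<in> {s. \<bar>s\<bar> \<in> S}"
    show "signed_rank S x = signed_rank S y \<longleftrightarrow> x = y"
    proof
      assume eq: "signed_rank S x = signed_rank S y"
      \<comment> \<open>The sign is read off from the half of the range in which the rank
        lies.\<close>
      have "0 < x \<longleftrightarrow> 0 < y"
        using eq lt[of "\<bar>x\<bar>"] lt[of "\<bar>y\<bar>"] xy
        by (auto simp: signed_rank_def Let_def split: if_splits)
      moreover from this have "\<bar>x\<bar> = \<bar>y\<bar>"
        using eq inj[of "\<bar>x\<bar>" "\<bar>y\<bar>"] xy by (auto simp: signed_rank_def Let_def split: if_splits)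
      ultimately show "x = y" using nz xy by (auto simp: abs_if split: if_splits)
    qed auto
  next
    fix x assume "x \<in> {s. \<bar>s\<bar> \<in> S}"
    thus "signed_rank S x \<in> {0..<2 * int (card S)}"
      using lt[of "\<bar>x\<bar>"] by (auto simp: signed_rank_def Let_def)
  next
    fix k assume k: "k \<in> {0..<2 * int (card S)}"
    show "\<exists>s\<in>{s. \<bar>s\<bar> \<in> S}. k = signed_rank S s"
    proof (cases "k < int (card S)")
      case True
      then obtain a where "a \<in> S" "card {c \<in> S. a < c} = nat k"
        using ex[of "nat k"] k by (auto simp: nat_less_iff)
      thus ?thesis using assms(2) k by (intro bexI[of _ a]) (auto simp: signed_rank_def)
    next
      case False
      then obtain a where a: "a \<in> S" "card {c \<in> S. a < c} = nat (2 * int (card S) - 1 - k)"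
        using ex[of "nat (2 * int (card S) - 1 - k)"] k by (auto simp: nat_less_iff)
      moreover have "0 < a" using a assms(2) by auto
      ultimately show ?thesis
        using k by (intro bexI[of _ "- a"]) (auto simp: signed_rank_def)
    qed
  qed
qed

lemma arrangements_SucE:
  assumes "\<sigma> \<in> arrangements S (Suc n)"
  shows "\<bar>\<sigma> (Suc n)\<bar> \<in> S" "restrict \<sigma> {1..n} \<in> arrangements (S - {\<bar>\<sigma> (Suc n)\<bar>}) n"
    "\<sigma> = (restrict \<sigma> {1..n})(Suc n := \<sigma> (Suc n))"
proof -
  have bij: "bij_betw (\<lambda>i. \<bar>\<sigma> i\<bar>) {1..Suc n} S" and ext: "\<sigma> \<in> extensional {1..Suc n}"
    using assms by (auto simp: arrangements_def)
  show "\<bar>\<sigma> (Suc n)\<bar> \<in> S" using bij_betwE[OF bij] by auto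
  have "bij_betw (\<lambda>i. \<bar>\<sigma> i\<bar>) ({1..Suc n} - {Suc n}) (S - {\<bar>\<sigma> (Suc n)\<bar>})"
    using bij by (intro bij_betw_DiffI) (auto simp: bij_betw_def)
  also have "{1..Suc n} - {Suc n} = {1..n}" by auto
  finally have "bij_betw (\<lambda>i. \<bar>restrict \<sigma> {1..n} i\<bar>) {1..n} (S - {\<bar>\<sigma> (Suc n)\<bar>})"
    by (subst bij_betw_cong[where g = "\<lambda>i. \<bar>\<sigma> i\<bar>"]) auto
  thus "restrict \<sigma> {1..n} \<in> arrangements (S - {\<bar>\<sigma> (Suc n)\<bar>}) n"
    by (simp add: arrangements_def del: restrict_apply)
  show "\<sigma> = (restrict \<sigma> {1..n})(Suc n := \<sigma> (Suc n))"
    using ext by (auto simp: fun_eq_iff extensional_def)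
qed

lemma arrangements_SucI:
  assumes "\<bar>s\<bar> \<in> S" "\<sigma> \<in> arrangements (S - {\<bar>s\<bar>}) n"
  shows "\<sigma>(Suc n := s) \<in> arrangements S (Suc n)"
proof -
  have bij: "bij_betw (\<lambda>i. \<bar>\<sigma> i\<bar>) {1..n} (S - {\<bar>s\<bar>})" and ext: "\<sigma> \<in> extensional {1..n}"
    using assms by (auto simp: arrangements_def)
  have "bij_betw (\<lambda>i. \<bar>(\<sigma>(Suc n := s)) i\<bar>) {1..n} (S - {\<bar>s\<bar>})"
    using bij by (subst bij_betw_cong) auto
  hence "bij_betw (\<lambda>i. \<bar>(\<sigma>(Suc n := s)) i\<bar>) ({1..n} \<union> {Suc n}) ((S - {\<bar>s\<bar>}) \<union> {\<bar>s\<bar>})"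
    by (rule bij_betw_combine) (auto simp: bij_betw_def)
  moreover have "{1..n} \<union> {Suc n} = {1..Suc n}" by auto
  moreover have "(S - {\<bar>s\<bar>}) \<union> {\<bar>s\<bar>} = S" using assms by auto
  ultimately show ?thesis
    using ext by (auto simp: arrangements_def extensional_def)
qed

text \<open>The entries before the last one have exactly the absolute values
  \<open>S - {\<bar>s\<bar>}\<close>, so counting earlier positions amounts to counting elements of
  \<open>S\<close>. The other digits look only at earlier positions and do not change.\<close>

lemma signed_lehmer_Suc:
  assumes "\<bar>s\<bar> \<in> S" "\<sigma> \<in> arrangements (S - {\<bar>s\<bar>}) n" "finite S" "card S = Suc n"
  shows "signed_lehmer (Suc n) (\<sigma>(Suc n := s)) = (signed_lehmer n \<sigma>)(Suc n := signed_rank S s)"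
proof
  fix i
  have bij: "bij_betw (\<lambda>i. \<bar>\<sigma> i\<bar>) {1..n} (S - {\<bar>s\<bar>})"
    using assms by (auto simp: arrangements_def)
  have "bij_betw (\<lambda>i. \<bar>\<sigma> i\<bar>) {j \<in> {1..n}. \<bar>s\<bar> < \<bar>\<sigma> j\<bar>} {b \<in> S. \<bar>s\<bar> < b}"
  proof (rule bij_betw_imageI)
    show "inj_on (\<lambda>i. \<bar>\<sigma> i\<bar>) {j \<in> {1..n}. \<bar>s\<bar> < \<bar>\<sigma> j\<bar>}"
      using bij_betw_imp_inj_on[OF bij] by (rule inj_on_subset) auto
    have img: "(\<lambda>i. \<bar>\<sigma> i\<bar>) ` {1..n} = S - {\<bar>s\<bar>}"
      using bij by (rule bij_betw_imp_surj_on)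
    have "{b \<in> S. \<bar>s\<bar> < b} = {b \<in> (\<lambda>i. \<bar>\<sigma> i\<bar>) ` {1..n}. \<bar>s\<bar> < b}"
      unfolding img by auto
    also have "\<dots> = (\<lambda>i. \<bar>\<sigma> i\<bar>) ` {j \<in> {1..n}. \<bar>s\<bar> < \<bar>\<sigma> j\<bar>}" by auto
    finally show "(\<lambda>i. \<bar>\<sigma> i\<bar>) ` {j \<in> {1..n}. \<bar>s\<bar> < \<bar>\<sigma> j\<bar>} = {b \<in> S. \<bar>s\<bar> < b}" ..
  qed
  hence card: "card {j \<in> {1..n}. \<bar>s\<bar> < \<bar>\<sigma> j\<bar>} = card {b \<in> S. \<bar>s\<bar> < b}"
    by (rule bij_betw_same_card)
  have 1: "{j \<in> {1..<Suc n}. \<bar>(\<sigma>(Suc n := s)) (Suc n)\<bar> < \<bar>(\<sigma>(Suc n := s)) j\<bar>} = {j \<in> {1..n}. \<bar>s\<bar> < \<bar>\<sigma> j\<bar>}"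
    by auto
  have 2: "{j \<in> {1..<i}. \<bar>(\<sigma>(Suc n := s)) i\<bar> < \<bar>(\<sigma>(Suc n := s)) j\<bar>} = {j \<in> {1..<i}. \<bar>\<sigma> i\<bar> < \<bar>\<sigma> j\<bar>}"
    if "i \<le> n" using that by auto
  consider "i = Suc n" | "i \<in> {1..n}" | "i \<notin> {1..Suc n}" by force
  thus "signed_lehmer (Suc n) (\<sigma>(Suc n := s)) i = ((signed_lehmer n \<sigma>)(Suc n := signed_rank S s)) i"
  proof cases
    assume i: "i = Suc n"
    have "signed_lehmer (Suc n) (\<sigma>(Suc n := s)) (Suc n) = signed_rank S s"
      unfolding signed_lehmer_def signed_rank_def 1 card assms(4) restrict_def Let_def by simp
    thus ?thesis by (simp add: i)
  next
    assume i: "i \<in> {1..n}"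
    hence le: "i \<le> n" by simp
    have "signed_lehmer (Suc n) (\<sigma>(Suc n := s)) i = signed_lehmer n \<sigma> i"
      using i unfolding signed_lehmer_def restrict_def Let_def 2[OF le] by simp
    thus ?thesis using i by simp
  next
    assume "i \<notin> {1..Suc n}"
    thus ?thesis by (auto simp: signed_lehmer_def)
  qed
qed

text \<open>The last digit determines the last entry through its rank in \<open>S\<close>; what
  remains is an arrangement of \<open>S\<close> without that absolute value, to which the induction
  hypothesis applies.\<close>

lemma bij_betw_signed_lehmer:
  assumes "finite S" "S \<subseteq> {0<..}" "card S = n"
  shows "bij_betw (signed_lehmer n) (arrangements S n) (inversion_seqs n)"
  using assms
proof (induction n arbitrary: S)
  case 0
  have "arrangements {} 0 = {\<lambda>_. undefined}" "inversion_seqs 0 = {\<lambda>_. undefined}"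
    by (simp_all add: arrangements_def inversion_seqs_def bij_betw_def)
  with 0 show ?case by (auto simp: bij_betw_def signed_lehmer_def)
next
  case (Suc n)
  have rank: "bij_betw (signed_rank S) {s. \<bar>s\<bar> \<in> S} {0..<2 * int (Suc n)}"
    using bij_betw_signed_rank Suc.prems by metis
  have IH: "bij_betw (signed_lehmer n) (arrangements (S - {\<bar>s\<bar>}) n) (inversion_seqs n)"
    if "\<bar>s\<bar> \<in> S" for s :: int
    using that Suc.prems by (intro Suc.IH) auto
  have split: "signed_lehmer (Suc n) \<sigma>
      = (signed_lehmer n (restrict \<sigma> {1..n}))(Suc n := signed_rank S (\<sigma> (Suc n)))"
    if "\<sigma> \<in> arrangements S (Suc n)" for \<sigma>
    using trans[OF arg_cong[OF arrangements_SucE(3)[OF that], of "signed_lehmer (Suc n)"]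
      signed_lehmer_Suc[OF arrangements_SucE(1,2)[OF that] Suc.prems(1,3)]] .
  \<comment> \<open>Since the shorter code has the default value at \<open>Suc n\<close>, it can be
    recovered after an update there.\<close>
  have undef: "signed_lehmer n \<sigma> (Suc n) = undefined" for \<sigma> by (simp add: signed_lehmer_def)
  show ?case
  proof (rule bij_betwI')
    fix \<sigma> \<tau> assume \<sigma>: "\<sigma> \<in> arrangements S (Suc n)" and \<tau>: "\<tau> \<in> arrangements S (Suc n)"
    show "signed_lehmer (Suc n) \<sigma> = signed_lehmer (Suc n) \<tau> \<longleftrightarrow> \<sigma> = \<tau>"
    proof
      assume eq: "signed_lehmer (Suc n) \<sigma> = signed_lehmer (Suc n) \<tau>"
      hence "signed_rank S (\<sigma> (Suc n)) = signed_rank S (\<tau> (Suc n))"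
        unfolding split[OF \<sigma>] split[OF \<tau>] by (metis fun_upd_same)
      hence last: "\<sigma> (Suc n) = \<tau> (Suc n)"
        using rank arrangements_SucE(1)[OF \<sigma>] arrangements_SucE(1)[OF \<tau>]
        by (auto simp: bij_betw_def inj_on_def)
      have "signed_lehmer n (restrict \<sigma> {1..n}) = signed_lehmer n (restrict \<tau> {1..n})"
        using eq undef unfolding split[OF \<sigma>] split[OF \<tau>] by (metis fun_upd_triv fun_upd_upd)
      moreover have "restrict \<tau> {1..n} \<in> arrangements (S - {\<bar>\<sigma> (Suc n)\<bar>}) n"
        using arrangements_SucE(2)[OF \<tau>] last by simp
      ultimately have "restrict \<sigma> {1..n} = restrict \<tau> {1..n}"
        using IH[OF arrangements_SucE(1)[OF \<sigma>]] arrangements_SucE(2)[OF \<sigma>]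
        by (auto simp: bij_betw_def inj_on_def)
      thus "\<sigma> = \<tau>"
        using last arrangements_SucE(3)[OF \<sigma>] arrangements_SucE(3)[OF \<tau>] by metis
    qed auto
  next
    fix \<sigma> assume \<sigma>: "\<sigma> \<in> arrangements S (Suc n)"
    note last = arrangements_SucE(1)[OF \<sigma>]
    have "signed_lehmer n (restrict \<sigma> {1..n}) \<in> inversion_seqs n"
      using bij_betwE[OF IH[OF last]] arrangements_SucE(2)[OF \<sigma>] by blast
    moreover have "signed_rank S (\<sigma> (Suc n)) \<in> {0..<2 * int (Suc n)}"
      using bij_betwE[OF rank] last by blast
    ultimately show "signed_lehmer (Suc n) \<sigma> \<in> inversion_seqs (Suc n)"
      unfolding split[OF \<sigma>] inversion_seqs_def by (auto simp: PiE_iff extensional_def)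
  next
    fix e assume e: "e \<in> inversion_seqs (Suc n)"
    hence "e (Suc n) \<in> {0..<2 * int (Suc n)}"
      unfolding inversion_seqs_def by (rule PiE_mem) simp
    then obtain s where s: "\<bar>s\<bar> \<in> S" "signed_rank S s = e (Suc n)"
      using bij_betw_imp_surj_on[OF rank] by (metis (mono_tags, lifting) imageE mem_Collect_eq)
    have "restrict e {1..n} \<in> inversion_seqs n" using e by (auto simp: inversion_seqs_def)
    then obtain \<sigma> where \<sigma>: "\<sigma> \<in> arrangements (S - {\<bar>s\<bar>}) n" "signed_lehmer n \<sigma> = restrict e {1..n}"
      using IH[OF s(1)] unfolding bij_betw_def by (metis imageE)
    have "e = (restrict e {1..n})(Suc n := e (Suc n))"
      using e by (auto simp: inversion_seqs_def fun_eq_iff PiE_iff extensional_def)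
    hence "e = signed_lehmer (Suc n) (\<sigma>(Suc n := s))"
      using signed_lehmer_Suc[OF s(1) \<sigma>(1) Suc.prems(1,3)] s(2) \<sigma>(2) by simp
    thus "\<exists>\<sigma>\<in>arrangements S (Suc n). e = signed_lehmer (Suc n) \<sigma>"
      using arrangements_SucI[OF s(1) \<sigma>(1)] by blast
  qed
qed

section \<open>Descents of signed permutations as ascents of codes\<close>

lemma divide_less_divide_Suc_iff:
  assumes "0 < i"
  shows "real_of_int a / real i < real_of_int b / real (i + 1) \<longleftrightarrow> a * (int i + 1) < b * int i"
proof -
  have "real_of_int a / real i < real_of_int b / real (i + 1) \<longleftrightarrow>
      real_of_int (a * (int i + 1)) < real_of_int (b * int i)"
    using assms by (simp add: field_simps)
  thus ?thesis by (simp only: of_int_less_iff)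
qed

text \<open>Here \<open>t\<close> and \<open>t'\<close> are the digits at positions \<open>I\<close>
  and \<open>I + 1\<close>. A code divided by its position is below 1 for a positive entry and at
  least 1 for a negative one, which settles opposite signs. For equal signs, multiplying out leaves
  a comparison of \<open>t * I\<close> with \<open>t' * I\<close> up to an error too small to
  matter, as \<open>0 \<le> t < I\<close>.\<close>

lemma signed_code_less_iff:
  fixes I t t' x y :: int
  assumes "0 < I" "0 \<le> t" "t < I" "0 \<le> t'" "t' \<le> I"
    and "x \<noteq> 0" "y \<noteq> 0" "\<bar>x\<bar> \<noteq> \<bar>y\<bar>" "t' \<le> t \<longleftrightarrow> \<bar>x\<bar> < \<bar>y\<bar>"
  shows "(if 0 < x then t else 2 * I - 1 - t) * (I + 1) < (if 0 < y then t' else 2 * I + 1 - t') * I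
    \<longleftrightarrow> y < x"
proof -
  have le: "t' * I \<le> t * I" if "t' \<le> t" using that assms(1) by (intro mult_right_mono) auto
  have gt: "t * I + I \<le> t' * I" if "\<not> t' \<le> t"
  proof -
    have "(t + 1) * I \<le> t' * I" using that assms(1) by (intro mult_right_mono) auto
    thus ?thesis by (simp add: algebra_simps)
  qed
  consider "0 < x" "0 < y" | "0 < x" "y < 0" | "x < 0" "0 < y" | "x < 0" "y < 0"
    using assms by linarith
  thus ?thesis
  proof cases
    case 1
    have "\<not> t * (I + 1) < t' * I" if "t' \<le> t"
      unfolding distrib_left using le[OF that] assms(2) by linarith
    moreover have "t * (I + 1) < t' * I" if "\<not> t' \<le> t"
      unfolding distrib_left using gt[OF that] assms(3) by linarith
    ultimately have "t * (I + 1) < t' * I \<longleftrightarrow> \<not> t' \<le> t" by blast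
    thus ?thesis using 1 assms by auto
  next
    case 2
    have "t * (I + 1) < I * (I + 1)" using assms by (intro mult_strict_right_mono) auto
    also have "\<dots> = (I + 1) * I" by simp
    also have "\<dots> \<le> (2 * I + 1 - t') * I" using assms by (intro mult_right_mono) auto
    finally show ?thesis using 2 by auto
  next
    case 3
    have "t' * I \<le> (I + 1) * I" using assms by (intro mult_right_mono) auto
    also have "\<dots> = I * (I + 1)" by simp
    also have "\<dots> \<le> (2 * I - 1 - t) * (I + 1)" using assms by (intro mult_right_mono) auto
    finally show ?thesis using 3 by auto
  next
    case 4
    have eq: "(2 * I - 1 - t) * (I + 1) = 2 * I * I + I - 1 - t * I - t"
      "(2 * I + 1 - t') * I = 2 * I * I + I - t' * I"
      by (simp_all add: algebra_simps)
    have "(2 * I - 1 - t) * (I + 1) < (2 * I + 1 - t') * I" if "t' \<le> t"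
      unfolding eq using le[OF that] assms(2) by linarith
    moreover have "\<not> (2 * I - 1 - t) * (I + 1) < (2 * I + 1 - t') * I" if "\<not> t' \<le> t"
      unfolding eq using gt[OF that] assms(3) by linarith
    ultimately have "(2 * I - 1 - t) * (I + 1) < (2 * I + 1 - t') * I \<longleftrightarrow> t' \<le> t" by blast
    thus ?thesis using 4 assms by auto
  qed
qed

lemma signed_lehmer_descent_iff:
  assumes "\<sigma> \<in> signed_perms n" "0 < i" "i < n"
  defines "e \<equiv> signed_lehmer n \<sigma>"
  shows "e i * (int i + 1) < e (i + 1) * int i \<longleftrightarrow> \<sigma> (i + 1) < \<sigma> i"
proof -
  define t where "t = int (card {j \<in> {1..<i}. \<bar>\<sigma> i\<bar> < \<bar>\<sigma> j\<bar>})"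
  define t' where "t' = int (card {j \<in> {1..<i + 1}. \<bar>\<sigma> (i + 1)\<bar> < \<bar>\<sigma> j\<bar>})"
  have bij: "bij_betw (\<lambda>i. \<bar>\<sigma> i\<bar>) {1..n} {1..int n}"
    using assms by (simp add: signed_perms_def)
  have nz: "\<sigma> i \<noteq> 0" "\<sigma> (i + 1) \<noteq> 0"
    using bspec[OF bij_betwE[OF bij], of i] bspec[OF bij_betwE[OF bij], of "i + 1"] assms(2,3)
    by auto
  have neq: "\<bar>\<sigma> i\<bar> \<noteq> \<bar>\<sigma> (i + 1)\<bar>"
  proof
    assume "\<bar>\<sigma> i\<bar> = \<bar>\<sigma> (i + 1)\<bar>"
    from inj_onD[OF bij_betw_imp_inj_on[OF bij] this] show False using assms(2,3) by auto
  qed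
  have e: "e i = (if 0 < \<sigma> i then t else 2 * int i - 1 - t)"
    "e (i + 1) = (if 0 < \<sigma> (i + 1) then t' else 2 * int i + 1 - t')"
    using assms(2,3) by (auto simp: e_def t_def t'_def signed_lehmer_def Let_def)
  have "card {j \<in> {1..<i}. \<bar>\<sigma> i\<bar> < \<bar>\<sigma> j\<bar>} \<le> card {1..<i}"
    "card {j \<in> {1..<i + 1}. \<bar>\<sigma> (i + 1)\<bar> < \<bar>\<sigma> j\<bar>} \<le> card {1..<i + 1}"
    by (intro card_mono; auto)+
  hence t: "0 \<le> t" "t < int i" "0 \<le> t'" "t' \<le> int i"
    using assms(2) by (auto simp: t_def t'_def)
  have tt': "t' \<le> t \<longleftrightarrow> \<bar>\<sigma> i\<bar> < \<bar>\<sigma> (i + 1)\<bar>"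
  proof
    assume "\<bar>\<sigma> i\<bar> < \<bar>\<sigma> (i + 1)\<bar>"
    hence "{j \<in> {1..<i + 1}. \<bar>\<sigma> (i + 1)\<bar> < \<bar>\<sigma> j\<bar>} \<subseteq> {j \<in> {1..<i}. \<bar>\<sigma> i\<bar> < \<bar>\<sigma> j\<bar>}"
      by (auto simp: less_Suc_eq)
    thus "t' \<le> t" unfolding t_def t'_def by (auto intro!: card_mono)
  next
    assume le: "t' \<le> t"
    show "\<bar>\<sigma> i\<bar> < \<bar>\<sigma> (i + 1)\<bar>"
    proof (rule ccontr)
      assume "\<not> \<bar>\<sigma> i\<bar> < \<bar>\<sigma> (i + 1)\<bar>"
      \<comment> \<open>Position \<open>i\<close> itself is counted by \<open>t'\<close> but not by
        \<open>t\<close>, so that \<open>t < t'\<close>.\<close>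
      hence "insert i {j \<in> {1..<i}. \<bar>\<sigma> i\<bar> < \<bar>\<sigma> j\<bar>} \<subseteq> {j \<in> {1..<i + 1}. \<bar>\<sigma> (i + 1)\<bar> < \<bar>\<sigma> j\<bar>}"
        using neq assms(2) by auto
      hence "card (insert i {j \<in> {1..<i}. \<bar>\<sigma> i\<bar> < \<bar>\<sigma> j\<bar>})
          \<le> card {j \<in> {1..<i + 1}. \<bar>\<sigma> (i + 1)\<bar> < \<bar>\<sigma> j\<bar>}"
        by (intro card_mono) auto
      with le show False by (simp add: t_def t'_def)
    qed
  qed
  show ?thesis
    unfolding e using assms(2) t nz neq tt' by (intro signed_code_less_iff) auto
qed

text \<open>The sign of the sum is that of the entry with the larger absolute value. If this is
  \<open>\<sigma> 2\<close>, then \<open>e 2\<close> is 0 or 3 and decides alone; otherwise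
  \<open>e 2\<close> is 1 or 2 and \<open>e 1\<close> decides.\<close>

lemma signed_lehmer_zero_descent_iff:
  assumes "\<sigma> \<in> signed_perms n" "2 \<le> n"
  defines "e \<equiv> signed_lehmer n \<sigma>"
  shows "real_of_int (e 1) + real_of_int (e 2) / 2 \<ge> 3 / 2 \<longleftrightarrow> \<sigma> 1 + \<sigma> 2 < 0"
proof -
  have bij: "bij_betw (\<lambda>i. \<bar>\<sigma> i\<bar>) {1..n} {1..int n}"
    using assms by (simp add: signed_perms_def)
  have nz: "\<sigma> 1 \<noteq> 0" "\<sigma> 2 \<noteq> 0"
    using bspec[OF bij_betwE[OF bij], of 1] bspec[OF bij_betwE[OF bij], of 2] assms(2)
    by auto
  have neq: "\<bar>\<sigma> 1\<bar> \<noteq> \<bar>\<sigma> 2\<bar>"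
  proof
    assume "\<bar>\<sigma> 1\<bar> = \<bar>\<sigma> 2\<bar>"
    from inj_onD[OF bij_betw_imp_inj_on[OF bij] this] show False using assms(2) by auto
  qed
  have "{j \<in> {1..<2}. \<bar>\<sigma> 2\<bar> < \<bar>\<sigma> j\<bar>} = (if \<bar>\<sigma> 2\<bar> < \<bar>\<sigma> 1\<bar> then {1} else {})"
    by (auto simp: numeral_2_eq_2 less_Suc_eq)
  hence card: "card {j \<in> {1..<2}. \<bar>\<sigma> 2\<bar> < \<bar>\<sigma> j\<bar>} = (if \<bar>\<sigma> 2\<bar> < \<bar>\<sigma> 1\<bar> then 1 else 0)"
    by simp
  have "e 1 = (if 0 < \<sigma> 1 then 0 else 1)"
    using assms(2) by (simp add: e_def signed_lehmer_def)
  moreover have "e 2 = (let t = (if \<bar>\<sigma> 2\<bar> < \<bar>\<sigma> 1\<bar> then 1 else 0) in if 0 < \<sigma> 2 then t else 3 - t)"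
    using assms(2) unfolding e_def signed_lehmer_def restrict_def card
    by (cases "\<bar>\<sigma> 2\<bar> < \<bar>\<sigma> 1\<bar>") (simp_all add: Let_def)
  ultimately show ?thesis
    using neq nz by (auto simp: Let_def abs_if split: if_splits)
qed

lemma asc_D_signed_lehmer:
  assumes "\<sigma> \<in> signed_perms n" "2 \<le> n"
  shows "asc_D n (signed_lehmer n \<sigma>) = des_D n \<sigma>"
proof -
  have "Asc_D n (signed_lehmer n \<sigma>) = Des_D n \<sigma>"
    unfolding Asc_D_def Des_D_def signed_lehmer_zero_descent_iff[OF assms]
    using signed_lehmer_descent_iff[OF assms(1)] divide_less_divide_Suc_iff by auto
  thus ?thesis by (simp add: asc_D_def des_D_def)
qed

lemma T_poly_eq_sum_asc:
  assumes "2 \<le> n"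
  shows "T_poly n = (\<Sum>e\<in>inversion_seqs n. monom 1 (asc_D n e))"
proof -
  have "signed_perms n = arrangements {1..int n} n"
    by (simp add: signed_perms_def arrangements_def)
  hence "bij_betw (signed_lehmer n) (signed_perms n) (inversion_seqs n)"
    using bij_betw_signed_lehmer[of "{1..int n}" n] by (simp add: subset_iff)
  from sum.reindex_bij_betw[OF this, of "\<lambda>e. monom 1 (asc_D n e)"] show ?thesis
    using assms by (simp add: T_poly_def asc_D_signed_lehmer cong: sum.cong)
qed

section \<open>The threshold recurrence\<close>

text \<open>The evaluation at \<open>z\<close> of the paper's \<open>T\<^sub>n\<^sub>,\<^sub>i\<close>.\<close>
definition asc_gf :: "nat \<Rightarrow> int \<Rightarrow> complex \<Rightarrow> complex" where
  "asc_gf n i z = (\<Sum>e\<in>{e \<in> inversion_seqs n. e n = i}. z ^ asc_D n e)"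

lemma bij_betw_inversion_seqs_Suc:
  assumes "0 \<le> i" "i < 2 * int (Suc n)"
  shows "bij_betw (\<lambda>e. e(Suc n := i)) (inversion_seqs n) {e \<in> inversion_seqs (Suc n). e (Suc n) = i}"
proof (rule bij_betw_byWitness[where f' = "\<lambda>e. restrict e {1..n}"])
  show "\<forall>e\<in>inversion_seqs n. restrict (e(Suc n := i)) {1..n} = e"
    by (auto simp: inversion_seqs_def PiE_iff extensional_def fun_eq_iff)
  show "\<forall>e\<in>{e \<in> inversion_seqs (Suc n). e (Suc n) = i}. (restrict e {1..n})(Suc n := i) = e"
    by (auto simp: inversion_seqs_def PiE_iff extensional_def fun_eq_iff)
  show "(\<lambda>e. e(Suc n := i)) ` inversion_seqs n \<subseteq> {e \<in> inversion_seqs (Suc n). e (Suc n) = i}"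
    using assms by (auto simp: inversion_seqs_def PiE_iff extensional_def)
  show "(\<lambda>e. restrict e {1..n}) ` {e \<in> inversion_seqs (Suc n). e (Suc n) = i} \<subseteq> inversion_seqs n"
    by (auto simp: inversion_seqs_def)
qed

lemma sum_inversion_seqs_last:
  assumes "0 < n"
  shows "(\<Sum>e\<in>inversion_seqs n. h e) = (\<Sum>i\<in>{0..<2 * int n}. \<Sum>e\<in>{e \<in> inversion_seqs n. e n = i}. h e)"
proof (rule sum.group[symmetric])
  show "(\<lambda>e. e n) ` inversion_seqs n \<subseteq> {0..<2 * int n}"
  proof
    fix i assume "i \<in> (\<lambda>e. e n) ` inversion_seqs n"
    then obtain e where "i = e n" "e \<in> (\<Pi>\<^sub>E i\<in>{1..n}. {0..<2 * int i})"
      by (auto simp: inversion_seqs_def)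
    with PiE_mem[OF this(2), of n] assms show "i \<in> {0..<2 * int n}" by simp
  qed
qed (auto simp: finite_inversion_seqs)

lemma asc_gf_Suc_sum:
  assumes "0 \<le> i" "i < 2 * int (Suc n)"
  shows "asc_gf (Suc n) i z = (\<Sum>e\<in>inversion_seqs n. z ^ asc_D (Suc n) (e(Suc n := i)))"
  unfolding asc_gf_def
  by (rule sum.reindex_bij_betw[OF bij_betw_inversion_seqs_Suc[OF assms], symmetric])

text \<open>Since \<open>2 \<le> n\<close>, the new entry at \<open>Suc n\<close> touches neither
  the condition for 0 nor the ascents below \<open>n\<close>; only \<open>n\<close> can become a new
  ascent.\<close>

lemma asc_D_Suc:
  assumes "2 \<le> n"
  shows "asc_D (Suc n) (e(Suc n := i)) = asc_D n e + (if e n * int (Suc n) < int n * i then 1 else 0)"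
proof -
  have fin: "finite (Asc_D n e)" by (simp add: Asc_D_def)
  have n: "n \<notin> Asc_D n e" using assms by (simp add: Asc_D_def)
  have "Asc_D (Suc n) (e(Suc n := i)) = Asc_D n e \<union> (if e n * int (Suc n) < int n * i then {n} else {})"
    using assms divide_less_divide_Suc_iff[of n "e n" i, symmetric]
    unfolding Asc_D_def by (auto simp: less_Suc_eq mult.commute add.commute)
  thus ?thesis using fin n by (simp add: asc_D_def)
qed

text \<open>The weight \<open>z\<close> falls on an initial segment of the indices \<open>l\<close>,
  and this segment grows with \<open>i\<close>.\<close>

lemma asc_gf_Suc:
  assumes "2 \<le> n" "0 \<le> i" "i < 2 * int (Suc n)"
  shows "asc_gf (Suc n) i z
    = (\<Sum>l\<in>{0..<2 * int n}. (if l * int (Suc n) < int n * i then z else 1) * asc_gf n l z)"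
proof -
  have "asc_gf (Suc n) i z = (\<Sum>l\<in>{0..<2 * int n}. \<Sum>e\<in>{e \<in> inversion_seqs n. e n = l}.
      z ^ (asc_D n e + (if e n * int (Suc n) < int n * i then 1 else 0)))"
    using assms by (simp only: asc_gf_Suc_sum asc_D_Suc sum_inversion_seqs_last)
  also have "\<dots> = (\<Sum>l\<in>{0..<2 * int n}. (if l * int (Suc n) < int n * i then z else 1) * asc_gf n l z)"
    by (intro sum.cong refl) (auto simp: asc_gf_def sum_distrib_left)
  finally show ?thesis .
qed

section \<open>Initial values of the recurrence\<close>

lemma asc_D_2: "asc_D 2 e = (if 2 * e 1 < e 2 then 1 else 0) + (if 3 \<le> 2 * e 1 + e 2 then 1 else 0)"
proof -
  have "{1..<2::nat} = {1}"
    unfolding numeral_2_eq_2 One_nat_def by (rule atLeastLessThan_singleton)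
  hence 1: "{i \<in> {1..<2::nat}. P i} = (if P 1 then {1} else {})" for P
    by auto
  have "real_of_int (e 1) / real 1 < real_of_int (e 2) / real 2 \<longleftrightarrow>
      real_of_int (2 * e 1) < real_of_int (e 2)"
    by (simp add: field_simps)
  hence 2: "real_of_int (e 1) / real 1 < real_of_int (e 2) / real 2 \<longleftrightarrow> 2 * e 1 < e 2"
    by (simp only: of_int_less_iff)
  have "real_of_int (e 1) + real_of_int (e 2) / 2 \<ge> 3 / 2 \<longleftrightarrow>
      real_of_int 3 \<le> real_of_int (2 * e 1 + e 2)"
    by (simp add: field_simps)
  hence 3: "real_of_int (e 1) + real_of_int (e 2) / 2 \<ge> 3 / 2 \<longleftrightarrow> 3 \<le> 2 * e 1 + e 2"
    by (simp only: of_int_le_iff)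
  show ?thesis unfolding asc_D_def Asc_D_def 1 one_add_one 2 3 by simp
qed

lemma inversion_seqs_1: "inversion_seqs 1 = {(\<lambda>_. undefined)(1 := 0), (\<lambda>_. undefined)(1 := 1)}"
proof -
  have "{0..<2 * int 1} = {0, 1}" by auto
  thus ?thesis unfolding inversion_seqs_def by (simp add: PiE_insert_eq)
qed

text \<open>Both choices of \<open>e 1\<close> give the same number of ascents; the four values are
  \<open>2\<close>, \<open>2 * z\<close>, \<open>2 * z\<close>, \<open>2 * z^2\<close>. The last is
  turned from the first by twice the argument of \<open>z\<close>, so they form no sector
  chain.\<close>

lemma asc_gf_2:
  assumes "i \<in> {0..<4}"
  shows "asc_gf 2 i z = 2 * z ^ nat ((i + 1) div 2)"
proof -
  define u where "u = (\<lambda>_::nat. undefined :: int)"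
  have "u(1 := 0) \<noteq> u(1 := 1)" by (metis fun_upd_same zero_neq_one)
  hence "(\<Sum>e\<in>inversion_seqs 1. z ^ asc_D 2 (e(2 := i)))
      = z ^ asc_D 2 (u(1 := 0, 2 := i)) + z ^ asc_D 2 (u(1 := 1, 2 := i))"
    unfolding inversion_seqs_1 u_def by (subst sum.insert) auto
  moreover have "asc_gf 2 i z = (\<Sum>e\<in>inversion_seqs 1. z ^ asc_D 2 (e(2 := i)))"
    using asc_gf_Suc_sum[of i 1 z] assms by (simp add: numeral_2_eq_2)
  ultimately have eq: "asc_gf 2 i z = z ^ asc_D 2 (u(1 := 0, 2 := i)) + z ^ asc_D 2 (u(1 := 1, 2 := i))"
    by simp
  consider "i = 0" | "i = 1" | "i = 2" | "i = 3" using assms by force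
  thus ?thesis unfolding eq asc_D_2 by cases (simp_all add: power2_eq_square)
qed

section \<open>Complex values of the real polynomials\<close>

lemma map_poly_of_real_sum:
  "map_poly complex_of_real (sum p A) = (\<Sum>a\<in>A. map_poly complex_of_real (p a))"
  by (rule poly_eqI) (simp add: coeff_map_poly coeff_sum)

lemma poly_map_poly_sum_monom:
  "poly (map_poly complex_of_real (\<Sum>e\<in>A. monom 1 (f e))) z = (\<Sum>e\<in>A. z ^ f e)"
  by (simp add: map_poly_of_real_sum poly_sum map_poly_monom poly_monom)

lemma poly_T_poly_last: "poly (map_poly of_real (T_poly_last n i)) z = asc_gf n i z"
  by (simp add: T_poly_last_def asc_gf_def poly_map_poly_sum_monom)

lemma poly_map_poly_of_real_cnj:
  "poly (map_poly complex_of_real p) (cnj z) = cnj (poly (map_poly complex_of_real p) z)"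
  by (simp add: poly_altdef coeff_map_poly degree_map_poly)

text \<open>Nonreal roots of a real polynomial come in conjugate pairs, so it suffices to exclude
  the upper half plane.\<close>

lemma only_real_rootsI:
  assumes "\<And>z. 0 < Im z \<Longrightarrow> poly (map_poly complex_of_real p) z \<noteq> 0"
  shows "only_real_roots p"
  unfolding only_real_roots_def
proof (intro allI impI)
  fix z :: complex
  assume z: "poly (map_poly of_real p) z = 0"
  have "\<not> 0 < Im z" using assms z by blast
  moreover have "\<not> 0 < Im (cnj z)" using assms[of "cnj z"] z by (auto simp: poly_map_poly_of_real_cnj)
  ultimately show "z \<in> \<real>" by (simp add: complex_is_Real_iff)
qed

section \<open>Sectors in the upper half plane\<close>

text \<open>\<open>ccw u v\<close>: the argument of \<open>v\<close> exceeds that of \<open>u\<close> by an angle in \<open>[0, \<pi>]\<close>;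
  \<open>sector z u v\<close>, for \<open>z\<close> in the upper half plane: by an angle in \<open>[0, arg z]\<close>.\<close>
definition ccw :: "complex \<Rightarrow> complex \<Rightarrow> bool" where
  "ccw u v \<longleftrightarrow> 0 \<le> Im (cnj u * v)"

definition sector :: "complex \<Rightarrow> complex \<Rightarrow> complex \<Rightarrow> bool" where
  "sector z u v \<longleftrightarrow> ccw u v \<and> ccw v (z * u)"

lemma ccw_refl: "ccw u u"
  by (simp add: ccw_def mult.commute)

lemma ccw_mult_self:
  assumes "0 \<le> Im z"
  shows "ccw u (z * u)"
proof -
  have "Im (cnj u * (z * u)) = Im z * (cmod u)\<^sup>2"
    unfolding cmod_power2 by (simp add: algebra_simps power2_eq_square)
  thus ?thesis using assms by (simp only: ccw_def) simp
qed

lemma ccw_mult_both: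
  assumes "ccw u v"
  shows "ccw (z * u) (z * v)"
proof -
  have "Im (cnj (z * u) * (z * v)) = (cmod z)\<^sup>2 * Im (cnj u * v)"
    unfolding cmod_power2 by (simp add: algebra_simps power2_eq_square)
  thus ?thesis using assms by (simp only: ccw_def) (simp del: times_complex.sel)
qed

lemma sector_refl: "0 \<le> Im z \<Longrightarrow> sector z u u"
  by (simp add: sector_def ccw_refl ccw_mult_self)

text \<open>The form \<open>Im (cnj u * v)\<close> is bilinear over the reals, so nonnegativity on
  all pairs passes to sums. All pairs are required because \<open>ccw\<close> is not transitive in
  general.\<close>

lemma ccw_sum:
  assumes "\<And>i j. i \<in> A \<Longrightarrow> j \<in> B \<Longrightarrow> ccw (f i) (g j)"
  shows "ccw (sum f A) (sum g B)"
proof -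
  have "cnj (sum f A) * sum g B = (\<Sum>i\<in>A. \<Sum>j\<in>B. cnj (f i) * g j)"
    by (simp add: sum_product)
  thus ?thesis
    using assms by (auto simp: ccw_def simp del: times_complex.sel intro!: sum_nonneg)
qed

lemma sector_sum:
  assumes "\<And>i j. i \<in> A \<Longrightarrow> j \<in> B \<Longrightarrow> sector z (f i) (g j)"
  shows "sector z (sum f A) (sum g B)"
  using assms unfolding sector_def by (auto simp: sum_distrib_left intro!: ccw_sum)

text \<open>The values \<open>a\<close>, \<open>b\<close>, \<open>c\<close> stand for the sums over
  the indices below both thresholds, between them and above both. After cancellation, every term of
  the two forms is, up to a factor \<open>(cmod z)^2\<close>, either \<open>Im z\<close> times a
  squared modulus or nonnegative by a sector hypothesis.\<close>

lemma sector_step: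
  assumes "0 \<le> Im z" "sector z a b" "sector z a c" "sector z b c"
  shows "sector z (z * a + b + c) (z * a + z * b + c)"
proof -
  let ?N = "(cmod z)\<^sup>2"
  have 1: "Im (cnj (z * a + b + c) * (z * a + z * b + c)) =
    ?N * Im (cnj a * b) + Im (cnj b * (z * a)) + Im z * (cmod b)\<^sup>2 + Im (cnj b * c)
      + Im (cnj c * (z * b))"
    unfolding cmod_power2 by (simp add: algebra_simps power2_eq_square)
  have 2: "Im (cnj (z * a + z * b + c) * (z * (z * a + b + c))) =
    Im z * (cmod (z * a + c))\<^sup>2 + ?N * Im (cnj a * b) + ?N * Im (cnj b * (z * a))
      + ?N * Im (cnj b * c) + Im (cnj c * (z * b))"
    unfolding cmod_power2 by (simp add: algebra_simps power2_eq_square)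
  show ?thesis
    using assms unfolding sector_def ccw_def 1 2
    by (intro conjI add_nonneg_nonneg mult_nonneg_nonneg) auto
qed

text \<open>If \<open>v = - u\<close>, the angle from \<open>u\<close> to \<open>v\<close> would be
  \<pi>, which exceeds the argument of \<open>z\<close>.\<close>

lemma sector_add_nonzero:
  assumes "0 < Im z" "sector z u v" "u \<noteq> 0"
  shows "u + v \<noteq> 0"
proof
  assume "u + v = 0"
  hence v: "v = - u" by (simp add: eq_neg_iff_add_eq_0 add.commute)
  have "Im (cnj v * (z * u)) = - (Im z * (cmod u)\<^sup>2)"
    unfolding v cmod_power2 by (simp add: algebra_simps power2_eq_square)
  moreover have "0 < Im z * (cmod u)\<^sup>2" using assms by simp
  ultimately show False using assms(2) by (simp add: sector_def ccw_def)
qed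

text \<open>If \<open>v = - (z * u)\<close> with \<open>u \<noteq> 0\<close>, then \<open>v\<close>
  would lie strictly clockwise of \<open>u\<close>; if \<open>u = 0\<close>, then
  \<open>v = 0\<close> as well, against \<open>u + v \<noteq> 0\<close>.\<close>

lemma sector_mult_add_nonzero:
  assumes "0 < Im z" "sector z u v" "u + v \<noteq> 0"
  shows "z * u + v \<noteq> 0"
proof
  assume "z * u + v = 0"
  hence v: "v = - (z * u)" by (simp add: eq_neg_iff_add_eq_0 add.commute)
  have "Im (cnj u * v) = - (Im z * (cmod u)\<^sup>2)"
    unfolding v cmod_power2 by (simp add: algebra_simps power2_eq_square)
  hence "Im z * (cmod u)\<^sup>2 \<le> 0"
    using assms(2) by (simp add: sector_def ccw_def)
  hence "u = 0" using assms(1) by (simp add: mult_le_0_iff)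
  with v assms(3) show False by simp
qed

text \<open>The sector of \<open>a\<close> is the convex cone spanned by \<open>a\<close> and
  \<open>z * a\<close>. Its two defining forms are the coordinates \<open>q\<close> and
  \<open>p\<close> up to positive factors.\<close>

lemma sector_coords:
  assumes "0 < Im z" "a \<noteq> 0" "sector z a u"
  obtains p q where "0 \<le> p" "0 \<le> q" "u = (of_real p + of_real q * z) * a"
proof -
  define w where "w = u / a"
  define q where "q = Im w / Im z"
  define p where "p = Re w - q * Re z"
  have u: "u = w * a" using assms by (simp add: w_def)
  have w: "w = of_real p + of_real q * z"
    using assms(1) by (simp add: complex_eq_iff p_def q_def)
  have "Im (cnj a * u) = (cmod a)\<^sup>2 * (q * Im z)"
    unfolding u w cmod_power2 by (simp add: algebra_simps power2_eq_square)
  hence "0 \<le> q * Im z" using assms by (simp add: sector_def ccw_def zero_le_mult_iff)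
  moreover have "Im (cnj u * (z * a)) = (cmod a)\<^sup>2 * (p * Im z)"
    unfolding u w cmod_power2 by (simp add: algebra_simps power2_eq_square)
  hence "0 \<le> p * Im z" using assms by (simp add: sector_def ccw_def zero_le_mult_iff)
  ultimately show ?thesis
    using that[of p q] assms(1) u w by (simp add: zero_le_mult_iff)
qed

text \<open>In cone coordinates the form is a positive multiple of the determinant
  \<open>p * s - r * q\<close>, so that \<open>ccw\<close> compares slopes.\<close>

lemma ccw_coords:
  assumes "0 < Im z" "a \<noteq> 0"
  shows "ccw ((of_real p + of_real q * z) * a) ((of_real r + of_real s * z) * a) \<longleftrightarrow> r * q \<le> p * s"
proof -
  have "Im (cnj ((of_real p + of_real q * z) * a) * ((of_real r + of_real s * z) * a))
      = (cmod a)\<^sup>2 * Im z * (p * s - r * q)"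
    unfolding cmod_power2 by (simp add: algebra_simps power2_eq_square)
  also have "0 \<le> \<dots> \<longleftrightarrow> 0 \<le> p * s - r * q"
    using assms by (subst mult_le_cancel_left_pos[of _ 0, simplified]) auto
  finally show ?thesis unfolding ccw_def by simp
qed

text \<open>Inside a cone of angle less than \<pi> the relation compares slopes and becomes
  transitive. The middle vector must be nonzero, because 0 is related to every vector.\<close>

lemma ccw_trans:
  assumes "0 < Im z" "a \<noteq> 0" "sector z a u" "sector z a v" "sector z a w"
    and "v \<noteq> 0" "ccw u v" "ccw v w"
  shows "ccw u w"
proof -
  obtain p1 q1 where u: "0 \<le> p1" "0 \<le> q1" "u = (of_real p1 + of_real q1 * z) * a"
    using sector_coords assms by metis
  obtain p2 q2 where v: "0 \<le> p2" "0 \<le> q2" "v = (of_real p2 + of_real q2 * z) * a"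
    using sector_coords assms by metis
  obtain p3 q3 where w: "0 \<le> p3" "0 \<le> q3" "w = (of_real p3 + of_real q3 * z) * a"
    using sector_coords assms by metis
  have uv: "p2 * q1 \<le> p1 * q2" and vw: "p3 * q2 \<le> p2 * q3"
    using assms ccw_coords u v w by auto
  have "p3 * q1 \<le> p1 * q3"
  \<comment> \<open>If \<open>p2 = 0\<close>, then \<open>v\<close> lies on the ray of
    \<open>z * a\<close> that bounds the cone, and so must \<open>w\<close>.\<close>
  proof (cases "p2 = 0")
    case True
    with assms(6) v have "0 < q2" by (cases "q2 = 0") auto
    with vw True have "p3 \<le> 0" by (simp add: mult_le_0_iff)
    with w u show ?thesis by simp
  next
    case False
    have "p2 * (p3 * q1) \<le> p3 * (p1 * q2)" using mult_left_mono[OF uv, of p3] w by (simp add: mult_ac)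
    also have "\<dots> \<le> p2 * (p1 * q3)" using mult_left_mono[OF vw, of p1] u by (simp add: mult_ac)
    finally show ?thesis using False v by simp
  qed
  thus ?thesis using assms ccw_coords u w by auto
qed

text \<open>Two vectors of a cone of angle \<open>arg z\<close> differ by at most this
  angle.\<close>

lemma ccw_imp_sector:
  assumes "0 < Im z" "a \<noteq> 0" "sector z a u" "sector z a v" "ccw u v"
  shows "sector z u v"
proof -
  obtain p q where u: "0 \<le> p" "0 \<le> q" "u = (of_real p + of_real q * z) * a"
    using sector_coords assms by metis
  obtain r s where v: "0 \<le> r" "0 \<le> s" "v = (of_real r + of_real s * z) * a"
    using sector_coords assms by metis
  have le: "r * q \<le> p * s" using assms ccw_coords u v by auto
  have eq: "Im (cnj v * (z * u)) = (cmod a)\<^sup>2 * Im z * (p * r + 2 * Re z * (r * q) + (cmod z)\<^sup>2 * (q * s))"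
    unfolding u v cmod_power2 by (simp add: algebra_simps power2_eq_square)
  \<comment> \<open>For \<open>Re z < 0\<close> the middle term of \<open>eq\<close> can be
    negative. By \<open>le\<close> and the inequality of arithmetic and geometric means, the two
    outer terms dominate it.\<close>
  have "(Re z * (r * q))\<^sup>2 \<le> (cmod z)\<^sup>2 * ((r * q) * (p * s))"
  proof -
    have "(Re z)\<^sup>2 * ((r * q) * (r * q)) \<le> (cmod z)\<^sup>2 * ((r * q) * (p * s))"
      using le u v by (intro mult_mono[OF _ mult_left_mono]) (auto simp: cmod_power2)
    thus ?thesis by (simp add: power2_eq_square mult_ac)
  qed
  also have "\<dots> = (p * r) * ((cmod z)\<^sup>2 * (q * s))" by (simp add: mult_ac)
  also have "4 * \<dots> \<le> (p * r + (cmod z)\<^sup>2 * (q * s))\<^sup>2"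
    using zero_le_power2[of "p * r - (cmod z)\<^sup>2 * (q * s)"]
    by (simp add: power2_eq_square algebra_simps)
  finally have "(2 * (Re z * (r * q)))\<^sup>2 \<le> (p * r + (cmod z)\<^sup>2 * (q * s))\<^sup>2" 
    by (simp add: power_mult_distrib)
  hence "\<bar>2 * (Re z * (r * q))\<bar> \<le> p * r + (cmod z)\<^sup>2 * (q * s)"
    using u v by (metis abs_le_square_iff abs_of_nonneg add_nonneg_nonneg mult_nonneg_nonneg zero_le_power2)
  hence "0 \<le> p * r + 2 * Re z * (r * q) + (cmod z)\<^sup>2 * (q * s)" by linarith
  thus ?thesis using assms by (simp only: sector_def ccw_def eq) simp
qed

lemma sector_mult_both: "sector z u v \<Longrightarrow> sector z (c * u) (c * v)"
  using ccw_mult_both[of u v c] ccw_mult_both[of v "z * u" c]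
  by (simp add: sector_def mult.left_commute)

section \<open>Threshold sums of sector chains\<close>

lemma sum_if_mult_eq:
  fixes z :: "'a :: comm_semiring_1"
  assumes "finite I"
  shows "(\<Sum>l\<in>I. (if P l then z else 1) * f l) = z * sum f {l \<in> I. P l} + sum f {l \<in> I. \<not> P l}"
proof -
  have "(\<Sum>l\<in>I. (if P l then z else 1) * f l) = (\<Sum>l\<in>I. if P l then z * f l else f l)"
    by (rule sum.cong) auto
  also have "\<dots> = (\<Sum>l\<in>I \<inter> {l. P l}. z * f l) + sum f (I \<inter> - {l. P l})"
    by (rule sum.If_cases[OF assms])
  also have "I \<inter> {l. P l} = {l \<in> I. P l}" by auto
  also have "I \<inter> - {l. P l} = {l \<in> I. \<not> P l}" by auto
  finally show ?thesis by (simp add: sum_distrib_left)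
qed

text \<open>Thresholds enter as nested downward closed predicates. They cut \<open>I\<close> into
  three consecutive blocks, and only the middle block changes its weight from 1 to
  \<open>z\<close>.\<close>

lemma sector_threshold_sum:
  fixes f :: "'i :: linorder \<Rightarrow> complex"
  assumes "0 \<le> Im z" "finite I"
    and chain: "\<And>i j. i \<in> I \<Longrightarrow> j \<in> I \<Longrightarrow> i \<le> j \<Longrightarrow> sector z (f i) (f j)"
    and P: "\<And>i j. P j \<Longrightarrow> i \<le> j \<Longrightarrow> P i" and Q: "\<And>i j. Q j \<Longrightarrow> i \<le> j \<Longrightarrow> Q i"
    and PQ: "\<And>i. P i \<Longrightarrow> Q i"
  shows "sector z (\<Sum>l\<in>I. (if P l then z else 1) * f l) (\<Sum>l\<in>I. (if Q l then z else 1) * f l)"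
proof -
  define A B C where "A = {l \<in> I. P l}" and "B = {l \<in> I. Q l \<and> \<not> P l}" and "C = {l \<in> I. \<not> Q l}"
  have fin: "finite A" "finite B" "finite C" using assms(2) by (auto simp: A_def B_def C_def)
  have "{l \<in> I. \<not> P l} = B \<union> C" "{l \<in> I. Q l} = A \<union> B" "A \<inter> B = {}" "B \<inter> C = {}"
    using PQ by (auto simp: A_def B_def C_def)
  hence eq: "(\<Sum>l\<in>I. (if P l then z else 1) * f l) = z * sum f A + sum f B + sum f C"
    "(\<Sum>l\<in>I. (if Q l then z else 1) * f l) = z * sum f A + z * sum f B + sum f C"
    unfolding sum_if_mult_eq[OF assms(2)]
    using fin by (simp_all add: A_def[symmetric] C_def[symmetric] sum.union_disjoint algebra_simps)
  have leP: "i \<le> j" if "P i" "\<not> P j" for i j using P that by (meson linear)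
  have leQ: "i \<le> j" if "Q i" "\<not> Q j" for i j using Q that by (meson linear)
  have "sector z (sum f A) (sum f B)" by (intro sector_sum chain) (auto simp: A_def B_def leP)
  moreover have "sector z (sum f A) (sum f C)"
    by (intro sector_sum chain) (auto simp: A_def C_def leQ PQ)
  moreover have "sector z (sum f B) (sum f C)"
    by (intro sector_sum chain) (auto simp: B_def C_def leQ)
  ultimately show ?thesis unfolding eq using assms(1) by (simp add: sector_step)
qed

text \<open>The unweighted sum is nonzero because the rest lies in the sector of the first term
  \<open>f m\<close>. Putting the weight \<open>z\<close> on an initial segment then keeps it
  nonzero.\<close>

lemma sector_threshold_sum_nonzero:
  fixes f :: "'i :: linorder \<Rightarrow> complex"
  assumes "0 < Im z" "finite I"
    and chain: "\<And>i j. i \<in> I \<Longrightarrow> j \<in> I \<Longrightarrow> i \<le> j \<Longrightarrow> sector z (f i) (f j)"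
    and P: "\<And>i j. P j \<Longrightarrow> i \<le> j \<Longrightarrow> P i"
    and m: "m \<in> I" "\<And>i. i \<in> I \<Longrightarrow> m \<le> i" "f m \<noteq> 0"
  shows "(\<Sum>l\<in>I. (if P l then z else 1) * f l) \<noteq> 0"
proof -
  have "sector z (sum f {m}) (sum f (I - {m}))"
    using m by (intro sector_sum chain) auto
  hence "f m + sum f (I - {m}) \<noteq> 0" using assms by (intro sector_add_nonzero) auto
  hence "sum f I \<noteq> 0" using assms(2) m(1) by (simp add: sum.remove)
  moreover have "sum f I = sum f {l \<in> I. P l} + sum f {l \<in> I. \<not> P l}"
    using assms(2) by (subst sum.union_disjoint[symmetric]) (auto intro: sum.cong)
  moreover have "i \<le> j" if "P i" "\<not> P j" for i j using P that by (meson linear)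
  hence "sector z (sum f {l \<in> I. P l}) (sum f {l \<in> I. \<not> P l})"
    by (intro sector_sum chain) auto
  ultimately show ?thesis
    unfolding sum_if_mult_eq[OF assms(2)] using assms(1) by (intro sector_mult_add_nonzero) auto
qed

text \<open>All values lie in the sector of \<open>h 0\<close>, where \<open>ccw\<close> is
  transitive, so comparisons of neighbours suffice.\<close>

lemma sector_chain_if_consecutive:
  fixes h :: "nat \<Rightarrow> complex"
  assumes "0 < Im z" "h 0 \<noteq> 0"
    and "\<And>i. i \<le> m \<Longrightarrow> sector z (h 0) (h i)" "\<And>i. i < m \<Longrightarrow> h i \<noteq> 0"
    and "\<And>i. i < m \<Longrightarrow> ccw (h i) (h (Suc i))"
    and "i \<le> j" "j \<le> m"
  shows "sector z (h i) (h j)"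
proof -
  from \<open>i \<le> j\<close> \<open>j \<le> m\<close> have "ccw (h i) (h j)"
  proof (induction j rule: dec_induct)
    case base
    show ?case by (rule ccw_refl)
  next
    case (step j)
    with assms show ?case by (intro ccw_trans[of z "h 0" "h i" "h j" "h (Suc j)"]) auto
  qed
  thus ?thesis using ccw_imp_sector[of z "h 0" "h i" "h j"] assms by auto
qed

section \<open>The interlacing family of the base case\<close>

text \<open>The two differences are \<open>2 * \<i> * Im (cnj u * v)\<close> and
  \<open>2 * \<i> * Im z\<close>; their quotient is the Bezout form of the pair, here a nonnegative
  combination of squared moduli. Written with \<open>z\<close> and \<open>cnj z\<close>, the
  hypothesis is a polynomial identity.\<close>

lemma ccw_if_sos:
  assumes "0 \<le> Im z"
    and "cnj u * v - u * cnj v =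
      (z - cnj z) * (of_real a * (p * cnj p) + of_real b * (q * cnj q) + of_real c * (r * cnj r))"
    and "0 \<le> a" "0 \<le> b" "0 \<le> c"
  shows "ccw u v"
proof -
  define s where "s = a * (cmod p)\<^sup>2 + b * (cmod q)\<^sup>2 + c * (cmod r)\<^sup>2"
  have "cnj u * v - cnj (cnj u * v) = (z - cnj z) * of_real s"
    using assms(2) by (simp add: s_def complex_norm_square del: of_real_power)
  hence "Im (cnj u * v) = Im z * s"
    by (simp only: complex_diff_cnj) (simp add: complex_eq_iff)
  moreover have "0 \<le> s" using assms by (simp add: s_def)
  ultimately show ?thesis using assms(1) by (simp only: ccw_def) simp
qed

text \<open>The squares come from the \<open>LDL\<^sup>T\<close> decompositions of the Bezout matrices of the pairs
  of polynomials.\<close>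
lemma ccw_base_polynomials:
  fixes z :: complex
  assumes "0 \<le> Im z"
  shows
    "ccw (1 + 11 * z + 11 * z\<^sup>2 + z^3) (z * (10 + 12 * z + 2 * z\<^sup>2))"
    "ccw (1 + 11 * z + 11 * z\<^sup>2 + z^3) (z * (7 + 14 * z + 3 * z\<^sup>2))"
    "ccw (1 + 11 * z + 11 * z\<^sup>2 + z^3) (z * (5 + 14 * z + 5 * z\<^sup>2))"
    "ccw (1 + 11 * z + 11 * z\<^sup>2 + z^3) (z * (3 + 14 * z + 7 * z\<^sup>2))"
    "ccw (1 + 11 * z + 11 * z\<^sup>2 + z^3) (z * (2 + 12 * z + 10 * z\<^sup>2))"
    "ccw (10 + 12 * z + 2 * z\<^sup>2) (1 + 11 * z + 11 * z\<^sup>2 + z^3)"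
    "ccw (7 + 14 * z + 3 * z\<^sup>2) (1 + 11 * z + 11 * z\<^sup>2 + z^3)"
    "ccw (5 + 14 * z + 5 * z\<^sup>2) (1 + 11 * z + 11 * z\<^sup>2 + z^3)"
    "ccw (3 + 14 * z + 7 * z\<^sup>2) (1 + 11 * z + 11 * z\<^sup>2 + z^3)"
    "ccw (2 + 12 * z + 10 * z\<^sup>2) (1 + 11 * z + 11 * z\<^sup>2 + z^3)"
    "ccw (10 + 12 * z + 2 * z\<^sup>2) (7 + 14 * z + 3 * z\<^sup>2)"
    "ccw (7 + 14 * z + 3 * z\<^sup>2) (5 + 14 * z + 5 * z\<^sup>2)"
    "ccw (5 + 14 * z + 5 * z\<^sup>2) (3 + 14 * z + 7 * z\<^sup>2)"
    "ccw (3 + 14 * z + 7 * z\<^sup>2) (2 + 12 * z + 10 * z\<^sup>2)"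
proof -
  note sos = ccw_if_sos[OF assms]
  note expand = algebra_simps power2_eq_square power3_eq_cube
  show "ccw (1 + 11 * z + 11 * z\<^sup>2 + z^3) (z * (10 + 12 * z + 2 * z\<^sup>2))"
    by (rule sos[of _ _ "2 / 5" "5 + 6 * z + z\<^sup>2" "48 / 5" "z + z\<^sup>2" 0 0])
      (simp_all add: expand)
  show "ccw (1 + 11 * z + 11 * z\<^sup>2 + z^3) (z * (7 + 14 * z + 3 * z\<^sup>2))"
    by (rule sos[of _ _ "1 / 7" "7 + 14 * z + 3 * z\<^sup>2" "4 / 13" "13 * z + 5 * z\<^sup>2" "912 / 91" "z\<^sup>2"])
      (simp_all add: expand)
  show "ccw (1 + 11 * z + 11 * z\<^sup>2 + z^3) (z * (5 + 14 * z + 5 * z\<^sup>2))"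
    by (rule sos[of _ _ "1 / 5" "5 + 14 * z + 5 * z\<^sup>2" "4 / 5" "9 * z + 5 * z\<^sup>2" 16 "z\<^sup>2"])
      (simp_all add: expand)
  show "ccw (1 + 11 * z + 11 * z\<^sup>2 + z^3) (z * (3 + 14 * z + 7 * z\<^sup>2))"
    by (rule sos[of _ _ "1 / 3" "3 + 14 * z + 7 * z\<^sup>2" "4 / 141" "47 * z + 31 * z\<^sup>2" "912 / 47" "z\<^sup>2"])
      (simp_all add: expand)
  show "ccw (1 + 11 * z + 11 * z\<^sup>2 + z^3) (z * (2 + 12 * z + 10 * z\<^sup>2))"
    by (rule sos[of _ _ 2 "1 + 6 * z + 5 * z\<^sup>2" 48 "z + z\<^sup>2" 0 0])
      (simp_all add: expand)
  show "ccw (10 + 12 * z + 2 * z\<^sup>2) (1 + 11 * z + 11 * z\<^sup>2 + z^3)"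
    by (rule sos[of _ _ "2 / 49" "49 + 54 * z + 5 * z\<^sup>2" "48 / 49" "z + z\<^sup>2" 0 0])
      (simp_all add: expand)
  show "ccw (7 + 14 * z + 3 * z\<^sup>2) (1 + 11 * z + 11 * z\<^sup>2 + z^3)"
    by (rule sos[of _ _ "1 / 63" "63 + 74 * z + 7 * z\<^sup>2" "4 / 40761" "647 * z + 91 * z\<^sup>2" "912 / 647" "z\<^sup>2"])
      (simp_all add: expand)
  show "ccw (5 + 14 * z + 5 * z\<^sup>2) (1 + 11 * z + 11 * z\<^sup>2 + z^3)"
    by (rule sos[of _ _ "1 / 41" "41 + 50 * z + 5 * z\<^sup>2" "36 / 2009" "49 * z + 9 * z\<^sup>2" "144 / 49" "z\<^sup>2"])
      (simp_all add: expand)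
  show "ccw (3 + 14 * z + 7 * z\<^sup>2) (1 + 11 * z + 11 * z\<^sup>2 + z^3)"
    by (rule sos[of _ _ "1 / 19" "19 + 26 * z + 3 * z\<^sup>2" "4 / 4009" "211 * z + 47 * z\<^sup>2" "912 / 211" "z\<^sup>2"])
      (simp_all add: expand)
  show "ccw (2 + 12 * z + 10 * z\<^sup>2) (1 + 11 * z + 11 * z\<^sup>2 + z^3)"
    by (rule sos[of _ _ "2 / 5" "5 + 6 * z + z\<^sup>2" "48 / 5" "z + z\<^sup>2" 0 0])
      (simp_all add: expand)
  show "ccw (10 + 12 * z + 2 * z\<^sup>2) (7 + 14 * z + 3 * z\<^sup>2)"
    by (rule sos[of _ _ "8 / 7" "7 + 2 * z" "24 / 7" z 0 0])
      (simp_all add: expand)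
  show "ccw (7 + 14 * z + 3 * z\<^sup>2) (5 + 14 * z + 5 * z\<^sup>2)"
    by (rule sos[of _ _ "4 / 7" "7 + 5 * z" "96 / 7" z 0 0])
      (simp_all add: expand)
  show "ccw (5 + 14 * z + 5 * z\<^sup>2) (3 + 14 * z + 7 * z\<^sup>2)"
    by (rule sos[of _ _ "4 / 7" "7 + 5 * z" "96 / 7" z 0 0])
      (simp_all add: expand)
  show "ccw (3 + 14 * z + 7 * z\<^sup>2) (2 + 12 * z + 10 * z\<^sup>2)"
    by (rule sos[of _ _ 8 "1 + 2 * z" 24 z 0 0])
      (simp_all add: expand)
qed

text \<open>A root in the upper half plane would force \<open>b = - 2 * c * Re z\<close> and hence a
  negative discriminant.\<close>

lemma real_quadratic_nonzero:
  fixes a b c :: real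
  assumes "0 < Im z" "c \<noteq> 0" "4 * a * c \<le> b\<^sup>2"
  shows "of_real a + of_real b * z + of_real c * z\<^sup>2 \<noteq> 0"
proof
  assume eq: "of_real a + of_real b * z + of_real c * z\<^sup>2 = 0"
  from arg_cong[OF eq, of Im] have "Im z * (b + 2 * c * Re z) = 0"
    by (simp add: power2_eq_square algebra_simps)
  hence b: "b = - 2 * c * Re z" using assms(1) by simp
  from arg_cong[OF eq, of Re] have "a = c * ((Re z)\<^sup>2 + (Im z)\<^sup>2)"
    by (simp add: b power2_eq_square algebra_simps)
  hence "b\<^sup>2 - 4 * a * c = - (4 * (c * Im z)\<^sup>2)"
    by (simp add: b power2_eq_square algebra_simps)
  moreover have "0 < (c * Im z)\<^sup>2" using assms by simp
  ultimately show False using assms(3) by linarith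
qed

text \<open>The roots -3 and 0 of the second polynomial enclose the double root -1 of the first.
  These two do not interlace, so the chain cannot start here.\<close>

lemma asc_gf_3:
  "asc_gf 3 0 z = 2 * (1 + z)\<^sup>2" "asc_gf 3 1 z = 2 * (z * (3 + z))"
  "asc_gf 3 2 z = 2 * (z * (2 * (1 + z)))" "asc_gf 3 3 z = 2 * (z * (2 * (1 + z)))"
  "asc_gf 3 4 z = 2 * (z * (1 + 3 * z))" "asc_gf 3 5 z = 2 * (z * (1 + z)\<^sup>2)"
proof -
  have I: "{0..<2 * int 2} = {0, 1, 2, 3}" by auto
  have S: "Suc 2 = 3" by simp
  have "asc_gf 3 i z = (\<Sum>l\<in>{0, 1, 2, 3}. (if l * 3 < 2 * i then z else 1) * asc_gf 2 l z)"
    if "0 \<le> i" "i < 6" for i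
    using asc_gf_Suc[of 2 i z] that unfolding I S by simp
  note eq = this
  show "asc_gf 3 0 z = 2 * (1 + z)\<^sup>2" "asc_gf 3 1 z = 2 * (z * (3 + z))"
    "asc_gf 3 2 z = 2 * (z * (2 * (1 + z)))" "asc_gf 3 3 z = 2 * (z * (2 * (1 + z)))"
    "asc_gf 3 4 z = 2 * (z * (1 + 3 * z))" "asc_gf 3 5 z = 2 * (z * (1 + z)\<^sup>2)"
    by (simp_all add: eq asc_gf_2 power2_eq_square algebra_simps)
qed

lemma asc_gf_4:
  "asc_gf 4 0 z = 2 * (1 + 11 * z + 11 * z\<^sup>2 + z^3)"
  "asc_gf 4 1 z = 2 * (z * (10 + 12 * z + 2 * z\<^sup>2))"
  "asc_gf 4 2 z = 2 * (z * (7 + 14 * z + 3 * z\<^sup>2))"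
  "asc_gf 4 3 z = 2 * (z * (5 + 14 * z + 5 * z\<^sup>2))"
  "asc_gf 4 4 z = 2 * (z * (5 + 14 * z + 5 * z\<^sup>2))"
  "asc_gf 4 5 z = 2 * (z * (3 + 14 * z + 7 * z\<^sup>2))"
  "asc_gf 4 6 z = 2 * (z * (2 + 12 * z + 10 * z\<^sup>2))"
  "asc_gf 4 7 z = 2 * (z * (1 + 11 * z + 11 * z\<^sup>2 + z^3))"
proof -
  have I: "{0..<2 * int 3} = {0, 1, 2, 3, 4, 5}" by auto
  have S: "Suc 3 = 4" by simp
  have "asc_gf 4 i z = (\<Sum>l\<in>{0, 1, 2, 3, 4, 5}. (if l * 4 < 3 * i then z else 1) * asc_gf 3 l z)"
    if "0 \<le> i" "i < 8" for i
    using asc_gf_Suc[of 3 i z] that unfolding I S by simp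
  note eq = this
  show "asc_gf 4 0 z = 2 * (1 + 11 * z + 11 * z\<^sup>2 + z^3)"
    "asc_gf 4 1 z = 2 * (z * (10 + 12 * z + 2 * z\<^sup>2))"
    "asc_gf 4 2 z = 2 * (z * (7 + 14 * z + 3 * z\<^sup>2))"
    "asc_gf 4 3 z = 2 * (z * (5 + 14 * z + 5 * z\<^sup>2))"
    "asc_gf 4 4 z = 2 * (z * (5 + 14 * z + 5 * z\<^sup>2))"
    "asc_gf 4 5 z = 2 * (z * (3 + 14 * z + 7 * z\<^sup>2))"
    "asc_gf 4 6 z = 2 * (z * (2 + 12 * z + 10 * z\<^sup>2))"
    "asc_gf 4 7 z = 2 * (z * (1 + 11 * z + 11 * z\<^sup>2 + z^3))"
    by (simp_all add: eq asc_gf_3 power2_eq_square power3_eq_cube algebra_simps)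
qed

lemma asc_gf_4_nonzero:
  assumes "0 < Im z" "0 \<le> i" "i < 8"
  shows "asc_gf 4 i z \<noteq> 0"
proof -
  have z: "z \<noteq> 0" "1 + z \<noteq> 0" using assms(1) by (auto simp: complex_eq_iff)
  have q: "of_real a + of_real b * z + of_real c * z\<^sup>2 \<noteq> 0" if "c \<noteq> 0" "4 * a * c \<le> b\<^sup>2" for a b c :: real
    using real_quadratic_nonzero assms(1) that by blast
  have "1 + 11 * z + 11 * z\<^sup>2 + z^3 = (1 + z) * (1 + 10 * z + 1 * z\<^sup>2)"
    by (simp add: algebra_simps power2_eq_square power3_eq_cube)
  hence c: "1 + 11 * z + 11 * z\<^sup>2 + z^3 \<noteq> 0"
    using q[of 1 1 10] z(2) by simp
  have "i \<in> {0, 1, 2, 3, 4, 5, 6, 7}" using assms(2,3) by auto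
  moreover have "10 + 12 * z + 2 * z\<^sup>2 \<noteq> 0" "7 + 14 * z + 3 * z\<^sup>2 \<noteq> 0"
    "5 + 14 * z + 5 * z\<^sup>2 \<noteq> 0" "3 + 14 * z + 7 * z\<^sup>2 \<noteq> 0" "2 + 12 * z + 10 * z\<^sup>2 \<noteq> 0"
    \<comment> \<open>The instantiations list the coefficients in the order \<open>c\<close>,
      \<open>a\<close>, \<open>b\<close>, in which they occur in the premises of
      \<open>q\<close>.\<close>
    using q[of 2 10 12] q[of 3 7 14] q[of 5 5 14] q[of 7 3 14] q[of 10 2 12] by simp_all
  ultimately show ?thesis
    using z c by (auto simp only: asc_gf_4 insert_iff empty_iff mult_eq_0_iff zero_neq_numeral[symmetric])
qed

text \<open>Apart from the first, all polynomials carry a factor \<open>z\<close>. Their sector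
  condition relative to the first one then splits into two comparisons with \<open>h0\<close>, and
  the remaining neighbours are compared after cancelling \<open>z\<close>.\<close>

lemma asc_gf_4_chain:
  assumes "0 < Im z" "0 \<le> i" "i \<le> j" "j < 8"
  shows "sector z (asc_gf 4 i z) (asc_gf 4 j z)"
proof -
  have pos: "0 \<le> Im z" using assms(1) by simp
  define h0 where "h0 = 1 + 11 * z + 11 * z\<^sup>2 + z^3"
  \<comment> \<open>The index is shifted by one: \<open>q k\<close> belongs to
    \<open>h (Suc k)\<close>. The middle polynomial occurs twice, and the last entry is
    \<open>h0\<close> because the last polynomial is \<open>z\<close> times the first.\<close>
  define q where "q = (!) [10 + 12 * z + 2 * z\<^sup>2, 7 + 14 * z + 3 * z\<^sup>2, 5 + 14 * z + 5 * z\<^sup>2,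
    5 + 14 * z + 5 * z\<^sup>2, 3 + 14 * z + 7 * z\<^sup>2, 2 + 12 * z + 10 * z\<^sup>2, h0]"
  define h where "h k = asc_gf 4 (int k) z" for k
  have h0: "h 0 = 2 * h0" by (simp add: h_def h0_def asc_gf_4)
  have h: "h (Suc k) = 2 * (z * q k)" if "k < 7" for k
  proof -
    have "k = 0 \<or> k = 1 \<or> k = 2 \<or> k = 3 \<or> k = 4 \<or> k = 5 \<or> k = 6" using that by arith
    thus ?thesis by (elim disjE) (simp_all add: h_def q_def h0_def asc_gf_4)
  qed
  have q: "ccw h0 (z * q k)" "ccw (q k) h0" if "k < 7" for k
  proof -
    have "k = 0 \<or> k = 1 \<or> k = 2 \<or> k = 3 \<or> k = 4 \<or> k = 5 \<or> k = 6" using that by arith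
    hence "ccw h0 (z * q k) \<and> ccw (q k) h0"
      by (elim disjE) (simp_all add: q_def h0_def ccw_base_polynomials[OF pos] ccw_refl ccw_mult_self[OF pos])
    thus "ccw h0 (z * q k)" "ccw (q k) h0" by auto
  qed
  have qq: "ccw (q k) (q (Suc k))" if "k < 6" for k
  proof -
    have "k = 0 \<or> k = 1 \<or> k = 2 \<or> k = 3 \<or> k = 4 \<or> k = 5" using that by arith
    thus ?thesis by (elim disjE) (simp_all add: q_def h0_def ccw_base_polynomials[OF pos] ccw_refl)
  qed
  have sector: "sector z (h 0) (h k)" if "k \<le> 7" for k
  proof (cases k)
    case 0
    thus ?thesis by (simp add: sector_refl pos)
  next
    case (Suc l)
    hence "sector z h0 (z * q l)" using q[of l] that by (simp add: sector_def ccw_mult_both)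
    thus ?thesis using Suc that by (simp add: h h0 sector_mult_both)
  qed
  have "ccw (h k) (h (Suc k))" if "k < 7" for k
  proof (cases k)
    case 0
    thus ?thesis using sector[of 1] by (simp add: sector_def)
  next
    case (Suc l)
    thus ?thesis using that qq[of l] by (simp add: h ccw_mult_both)
  qed
  moreover have "h k \<noteq> 0" if "k < 7" for k
    using asc_gf_4_nonzero assms(1) that by (simp add: h_def)
  ultimately have "sector z (h (nat i)) (h (nat j))"
    using sector_chain_if_consecutive[OF assms(1), of h 7 "nat i" "nat j"] assms sector by auto
  thus ?thesis using assms by (simp add: h_def)
qed

section \<open>Real-rootedness\<close>

text \<open>The condition \<open>l * int (Suc n) < int n * i\<close> is downward closed in
  \<open>l\<close> and weakens as \<open>i\<close> grows, as the threshold lemma requires.\<close>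

lemma asc_gf_Suc_chain:
  assumes n: "2 \<le> n" and z: "0 < Im z"
    and chain: "\<And>i j. 0 \<le> i \<Longrightarrow> i \<le> j \<Longrightarrow> j < 2 * int n \<Longrightarrow> sector z (asc_gf n i z) (asc_gf n j z)"
    and ij: "0 \<le> i" "i \<le> j" "j < 2 * int (Suc n)"
  shows "sector z (asc_gf (Suc n) i z) (asc_gf (Suc n) j z)"
proof -
  have i: "i < 2 * int (Suc n)" and j: "0 \<le> j" using ij by auto
  show ?thesis
    unfolding asc_gf_Suc[OF n ij(1) i] asc_gf_Suc[OF n j ij(3)]
  proof (rule sector_threshold_sum)
    show "l * int (Suc n) < int n * i" if "k * int (Suc n) < int n * i" "l \<le> k" for l k
      by (rule le_less_trans[OF mult_right_mono[OF that(2) of_nat_0_le_iff] that(1)])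
    show "l * int (Suc n) < int n * j" if "k * int (Suc n) < int n * j" "l \<le> k" for l k
      by (rule le_less_trans[OF mult_right_mono[OF that(2) of_nat_0_le_iff] that(1)])
    show "l * int (Suc n) < int n * j" if "l * int (Suc n) < int n * i" for l
      by (rule less_le_trans[OF that mult_left_mono[OF ij(2) of_nat_0_le_iff]])
  qed (use z chain in auto)
qed

lemma asc_gf_Suc_nonzero:
  assumes n: "2 \<le> n" and z: "0 < Im z"
    and chain: "\<And>i j. 0 \<le> i \<Longrightarrow> i \<le> j \<Longrightarrow> j < 2 * int n \<Longrightarrow> sector z (asc_gf n i z) (asc_gf n j z)"
    and nz: "asc_gf n 0 z \<noteq> 0" and i: "0 \<le> i" "i < 2 * int (Suc n)"
  shows "asc_gf (Suc n) i z \<noteq> 0"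
  unfolding asc_gf_Suc[OF n i]
proof (rule sector_threshold_sum_nonzero[where m = 0])
  show "l * int (Suc n) < int n * i" if "k * int (Suc n) < int n * i" "l \<le> k" for l k
    by (rule le_less_trans[OF mult_right_mono[OF that(2) of_nat_0_le_iff] that(1)])
qed (use n z chain nz in auto)

lemma asc_gf_chain:
  assumes "4 \<le> n" "0 < Im z" "0 \<le> i" "i \<le> j" "j < 2 * int n"
  shows "sector z (asc_gf n i z) (asc_gf n j z)"
  using assms(1,3-5)
proof (induction n arbitrary: i j rule: nat_induct_at_least)
  case base
  thus ?case using asc_gf_4_chain assms(2) by simp
next
  case (Suc n)
  from Suc.hyps have "2 \<le> n" by simp
  from asc_gf_Suc_chain[OF this assms(2) Suc.IH Suc.prems] show ?case .
qed

lemma asc_gf_nonzero_ge_4: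
  assumes "4 \<le> n" "0 < Im z" "0 \<le> i" "i < 2 * int n"
  shows "asc_gf n i z \<noteq> 0"
  using assms(1,3-4)
proof (induction n arbitrary: i rule: nat_induct_at_least)
  case base
  thus ?case using asc_gf_4_nonzero assms(2) by simp
next
  case (Suc n)
  from Suc.hyps have "2 \<le> n" by simp
  moreover have "asc_gf n 0 z \<noteq> 0" using Suc.IH[of 0] Suc.hyps by simp
  ultimately show ?case
    using asc_gf_Suc_nonzero[OF _ assms(2) asc_gf_chain[OF Suc.hyps assms(2)] _ Suc.prems] by blast
qed

lemma asc_gf_nonzero:
  assumes "2 \<le> n" "0 < Im z" "0 \<le> i" "i < 2 * int n"
  shows "asc_gf n i z \<noteq> 0"
proof -
  consider "n = 2" | "n = 3" | "4 \<le> n" using assms(1) by linarith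
  thus ?thesis
  proof cases
    case 1
    have "z \<noteq> 0" using assms(2) by auto
    thus ?thesis using 1 assms(3,4) by (simp add: asc_gf_2)
  next
    case 2
    hence "i \<in> {0, 1, 2, 3, 4, 5}" using assms(3,4) by auto
    moreover have "z \<noteq> 0" "1 + z \<noteq> 0" "3 + z \<noteq> 0" "1 + 3 * z \<noteq> 0"
      using assms(2) by (auto simp: complex_eq_iff)
    ultimately have "asc_gf 3 i z \<noteq> 0"
      by (auto simp only: asc_gf_3 insert_iff empty_iff mult_eq_0_iff power_eq_0_iff
          zero_neq_numeral[symmetric])
    thus ?thesis using 2 by simp
  qed (use asc_gf_nonzero_ge_4 assms in blast)
qed

text \<open>Entries of an inversion sequence are nonnegative, so appending 0 creates no
  ascent.\<close>

lemma poly_T_poly: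
  assumes "2 \<le> n"
  shows "poly (map_poly of_real (T_poly n)) z = asc_gf (Suc n) 0 z"
proof -
  have "\<not> e n * int (Suc n) < int n * 0" if "e \<in> inversion_seqs n" for e
  proof -
    have "e n \<in> {0..<2 * int n}"
      using that assms PiE_mem[of e "{1..n}" "\<lambda>i. {0..<2 * int i}" n] by (simp add: inversion_seqs_def)
    thus ?thesis by (simp add: mult_less_0_iff)
  qed
  hence "asc_gf (Suc n) 0 z = (\<Sum>e\<in>inversion_seqs n. z ^ asc_D n e)"
    using assms by (simp add: asc_gf_Suc_sum asc_D_Suc del: of_nat_Suc)
  thus ?thesis using assms by (simp add: T_poly_eq_sum_asc poly_map_poly_sum_monom)
qed

theorem theorem3p15:
  fixes n :: nat
  assumes "n \<ge> 2"
  shows "only_real_roots (T_poly n) \<and>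
         (\<forall>i::int. 0 \<le> i \<and> i < 2 * int n \<longrightarrow> only_real_roots (T_poly_last n i))"
  using assms by (auto intro!: only_real_rootsI simp: poly_T_poly poly_T_poly_last asc_gf_nonzero)

end
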